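(* Let $n$ be a positive integer and let $D_n$ be the dihedral group of order $2n$. Consider the three-player avoidance game on $D_n$. Then: (1) Player 1 has a winning strategy if and only if $n \equiv 1 \pmod 3$. (2) Player 2 has a winning strategy if and only if $n \equiv 2 \pmod 3$ or $n \equiv 3 \pmod 9$. (3) Player 3 has a winning strategy if and only if $n \equiv 0 \pmod 9$ or $n \equiv 6 \pmod 9$.
   Context: $D_n = \langle r, f \mid r^n = f^2 = 1,\ f r f^{-1} = r^{-1}\rangle$ denotes the dihedral group of order $2n$. The three-player avoidance game on a nontrivial finite group $G$: Players 1, 2, 3 take turns in the cyclic order $1,2,3,1,2,3,\dots$, with Player 1 moving first. On each turn the player selects an element of $G$ that has not previously been selected by anyone. The game ends as soon as the set of all elements selected so far (by all players jointly) generates $G$. The player whose selection causes this is the loser (third place), the player who plays immediately before the loser in the cyclic order is the winner (first place), and the remaining player is the runner-up (second place). Thus if Player 1 wins, Player 3 is runner-up; if Player 2 wins, Player 1 is runner-up; if Player 3 wins, Player 2 is runner-up. Each player prefers winning to being runner-up, and being runner-up to losing; in particular, a player who cannot ensure victory for herself helps the opponent whose victory makes her runner-up. "Player $i$ has a winning strategy" means that Player $i$ is the winner when all three players play optimally with respect to these preferences, i.e. Player $i$ is the winner in the outcome determined by backward induction on this finite perfect-information game (this outcome is unique because each player's preference over the three possible winners is strict). *)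

theory Defs
  imports "HOL-Algebra.Algebra" "HOL-Number_Theory.Cong"
begin

text \<open>
  Since the presentation \<open>\<langle>r, f | r^n = f^2 = 1, f r f^-1 = r^-1\<rangle>\<close> defines a group of
  order \<open>2 * n\<close>, a group of that order generated by two elements satisfying the relations is
  the dihedral group up to isomorphism: see \<open>dihedral_group_exists\<close> and the universal property
  \<open>dihedral_universal\<close> below.
\<close>

definition dihedral_relations :: "nat \<Rightarrow> ('a, 'b) monoid_scheme \<Rightarrow> 'a \<Rightarrow> 'a \<Rightarrow> bool" where
  "dihedral_relations n G r f \<longleftrightarrow>
     r \<in> carrier G \<and> f \<in> carrier G \<and>
     r [^]\<^bsub>G\<^esub> n = \<one>\<^bsub>G\<^esub> \<and> f [^]\<^bsub>G\<^esub> (2::nat) = \<one>\<^bsub>G\<^esub> \<and>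
     f \<otimes>\<^bsub>G\<^esub> r \<otimes>\<^bsub>G\<^esub> inv\<^bsub>G\<^esub> f = inv\<^bsub>G\<^esub> r"

definition dihedral_group :: "nat \<Rightarrow> ('a, 'b) monoid_scheme \<Rightarrow> bool" where
  "dihedral_group n G \<longleftrightarrow>
     group G \<and> order G = 2 * n \<and>
     (\<exists>r f. dihedral_relations n G r f \<and> generate G {r, f} = carrier G)"

datatype player = P1 | P2 | P3

fun next_player :: "player \<Rightarrow> player" where
  "next_player P1 = P2"
| "next_player P2 = P3"
| "next_player P3 = P1"

fun prev_player :: "player \<Rightarrow> player" where
  "prev_player P1 = P3"
| "prev_player P2 = P1"
| "prev_player P3 = P2"

text \<open>
  \<open>place w p\<close> is the place (1, 2 or 3) of player \<open>p\<close> when \<open>w\<close> is the winner;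
  the loser is the player who comes directly after the winner.
\<close>

definition place :: "player \<Rightarrow> player \<Rightarrow> nat" where
  "place w p = (if p = w then 1 else if p = next_player w then 3 else 2)"

text \<open>
  \<open>bi_winner G S p\<close> is the winner determined by backward induction from the position in which
  \<open>S\<close> is the set of elements selected so far (not generating \<open>G\<close>) and \<open>p\<close> is to move.
  The finiteness test only serves termination.
\<close>

function bi_winner :: "('a, 'b) monoid_scheme \<Rightarrow> 'a set \<Rightarrow> player \<Rightarrow> player" where
  "bi_winner G S p =
     (if finite (carrier G) then
        arg_min_on (\<lambda>w. place w p)
          ((\<lambda>x. if generate G (insert x S) = carrier G then prev_player p
                else bi_winner G (insert x S) (next_player p)) ` (carrier G - S))
      else undefined)"
  by pat_completeness auto
termination
proof (relation "measure (\<lambda>(G, S, p). card (carrier G - S))", goal_cases)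
  case (2 G S p x)
  then have "carrier G - insert x S \<subset> carrier G - S" by auto
  with 2 have "card (carrier G - insert x S) < card (carrier G - S)"
    by (intro psubset_card_mono) auto
  then show ?case by (simp del: card_Diff_insert)
qed auto

declare bi_winner.simps [simp del]

definition has_winning_strategy :: "('a, 'b) monoid_scheme \<Rightarrow> player \<Rightarrow> bool" where
  "has_winning_strategy G i \<longleftrightarrow> bi_winner G {} P1 = i"

text \<open>Preferences are strict, so the minimum taken in \<open>bi_winner\<close> is attained only once.\<close>

lemma place_inj: "inj (\<lambda>w. place w p)"
proof (rule injI)
  fix v w assume "place v p = place w p"
  then show "v = w" by (cases v; cases w; cases p) (auto simp: place_def)
qed

lemma dihedral_group_exists:
  assumes "n > 0"
  shows "\<exists>G :: (int \<times> bool) monoid. dihedral_group n G"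
proof -
  define G :: "(int \<times> bool) monoid" where
    "G = \<lparr>carrier = {0..<int n} \<times> UNIV,
          monoid.mult = (\<lambda>(i, s) (j, t). ((if s then i - j else i + j) mod int n, s \<noteq> t)),
          one = (0, False)\<rparr>"
  have n: "int n > 0" using assms by simp
  have group: "group G"
  proof (rule groupI)
    fix x y z assume "x \<in> carrier G" "y \<in> carrier G" "z \<in> carrier G"
    then show "x \<otimes>\<^bsub>G\<^esub> y \<otimes>\<^bsub>G\<^esub> z = x \<otimes>\<^bsub>G\<^esub> (y \<otimes>\<^bsub>G\<^esub> z)"
      by (auto simp: G_def mod_simps algebra_simps split: prod.splits)
  next
    fix x assume x: "x \<in> carrier G"
    obtain i s where xs: "x = (i, s)" by (cases x)
    show "\<exists>y\<in>carrier G. y \<otimes>\<^bsub>G\<^esub> x = \<one>\<^bsub>G\<^esub>"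
      using x n xs
      by (intro bexI [of _ "if s then (i, s) else ((- i) mod int n, s)"])
        (auto simp: G_def mod_simps)
  qed (use n in \<open>auto simp: G_def\<close>)
  interpret group G by (rule group)
  define r where "r = (1 mod int n, False)"
  define f where "f = (0 :: int, True)"
  have rf: "r \<in> carrier G" "f \<in> carrier G" using n by (auto simp: G_def r_def f_def)
  have pow: "r [^]\<^bsub>G\<^esub> k = (int k mod int n, False)" for k :: nat
    by (induction k) (auto simp: nat_pow_def G_def r_def mod_simps algebra_simps)
  have ff: "f \<otimes>\<^bsub>G\<^esub> f = \<one>\<^bsub>G\<^esub>" by (simp add: G_def f_def)
  then have invf: "inv\<^bsub>G\<^esub> f = f" using rf by (simp add: inv_equality)
  have "f \<otimes>\<^bsub>G\<^esub> r \<otimes>\<^bsub>G\<^esub> f \<otimes>\<^bsub>G\<^esub> r = \<one>\<^bsub>G\<^esub>" by (simp add: G_def f_def r_def mod_simps)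
  then have "inv\<^bsub>G\<^esub> r = f \<otimes>\<^bsub>G\<^esub> r \<otimes>\<^bsub>G\<^esub> f" using rf by (simp add: inv_equality)
  then have rel: "dihedral_relations n G r f"
    using rf ff by (simp add: dihedral_relations_def invf pow numeral_2_eq_2) (simp add: G_def)
  have "x \<in> generate G {r, f}" if x: "x \<in> carrier G" for x
  proof -
    obtain i s where xs: "x = (i, s)" by (cases x)
    have i: "0 \<le> i" "i < int n" using x by (auto simp: xs G_def)
    have pow_in: "r [^]\<^bsub>G\<^esub> k \<in> generate G {r, f}" for k :: nat
      by (induction k) (auto intro: generate.intros)
    have "x = (if s then r [^]\<^bsub>G\<^esub> nat i \<otimes>\<^bsub>G\<^esub> f else r [^]\<^bsub>G\<^esub> nat i)"
      using i by (simp add: pow xs) (simp add: G_def f_def)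
    then show ?thesis
      using pow_in [of "nat i"] by (auto intro: generate.intros split: if_splits)
  qed
  then have "generate G {r, f} = carrier G"
    using generate_incl [of "{r, f}"] rf by auto
  moreover have "order G = 2 * n" by (simp add: order_def G_def)
  ultimately show ?thesis using group rel unfolding dihedral_group_def by blast
qed

lemma dihedral_normal_form:
  assumes "group H" and "dihedral_relations n H a b"
  shows "b \<otimes>\<^bsub>H\<^esub> b = \<one>\<^bsub>H\<^esub>"
    and "b \<otimes>\<^bsub>H\<^esub> a [^]\<^bsub>H\<^esub> (k::int) = a [^]\<^bsub>H\<^esub> (- k) \<otimes>\<^bsub>H\<^esub> b"
    and "a [^]\<^bsub>H\<^esub> (k mod int n) = a [^]\<^bsub>H\<^esub> k"
proof -
  interpret group H by fact
  have ab: "a \<in> carrier H" "b \<in> carrier H"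
    and an: "a [^]\<^bsub>H\<^esub> n = \<one>\<^bsub>H\<^esub>" and b2: "b [^]\<^bsub>H\<^esub> (2::nat) = \<one>\<^bsub>H\<^esub>"
    and conj: "b \<otimes>\<^bsub>H\<^esub> a \<otimes>\<^bsub>H\<^esub> inv\<^bsub>H\<^esub> b = inv\<^bsub>H\<^esub> a"
    using assms(2) by (auto simp: dihedral_relations_def)
  show bb: "b \<otimes>\<^bsub>H\<^esub> b = \<one>\<^bsub>H\<^esub>" using b2 ab by (simp add: numeral_2_eq_2)
  have ba: "b \<otimes>\<^bsub>H\<^esub> a = inv\<^bsub>H\<^esub> a \<otimes>\<^bsub>H\<^esub> b"
    using conj ab by (metis inv_solve_right m_closed inv_closed)
  have nat: "b \<otimes>\<^bsub>H\<^esub> a [^]\<^bsub>H\<^esub> m = inv\<^bsub>H\<^esub> (a [^]\<^bsub>H\<^esub> m) \<otimes>\<^bsub>H\<^esub> b" for m :: nat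
  proof (induction m)
    case (Suc m)
    have "b \<otimes>\<^bsub>H\<^esub> a [^]\<^bsub>H\<^esub> Suc m = inv\<^bsub>H\<^esub> (a [^]\<^bsub>H\<^esub> m) \<otimes>\<^bsub>H\<^esub> b \<otimes>\<^bsub>H\<^esub> a"
      using ab Suc.IH by (simp add: m_assoc [symmetric])
    also have "\<dots> = inv\<^bsub>H\<^esub> (a [^]\<^bsub>H\<^esub> m) \<otimes>\<^bsub>H\<^esub> inv\<^bsub>H\<^esub> a \<otimes>\<^bsub>H\<^esub> b"
      using ab by (simp add: m_assoc ba)
    also have "\<dots> = inv\<^bsub>H\<^esub> (a [^]\<^bsub>H\<^esub> Suc m) \<otimes>\<^bsub>H\<^esub> b"
      using ab by (simp add: inv_mult_group [symmetric] nat_pow_comm flip: nat_pow_Suc2)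
    finally show ?case .
  qed (use ab in auto)
  show "b \<otimes>\<^bsub>H\<^esub> a [^]\<^bsub>H\<^esub> k = a [^]\<^bsub>H\<^esub> (- k) \<otimes>\<^bsub>H\<^esub> b"
  proof (cases "k \<ge> 0")
    case True
    then obtain m where "k = int m" using nonneg_int_cases by blast
    then show ?thesis using nat [of m] ab by (simp add: int_pow_neg int_pow_int)
  next
    case False
    define m where "m = nat (- k)"
    have k: "k = - int m" using False by (simp add: m_def)
    define c where "c = a [^]\<^bsub>H\<^esub> m"
    have c: "c \<in> carrier H" using ab by (simp add: c_def)
    have "b \<otimes>\<^bsub>H\<^esub> c = inv\<^bsub>H\<^esub> c \<otimes>\<^bsub>H\<^esub> b" using nat by (simp add: c_def)
    then have "c \<otimes>\<^bsub>H\<^esub> b = b \<otimes>\<^bsub>H\<^esub> inv\<^bsub>H\<^esub> c"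
      using c ab by (metis inv_solve_left inv_solve_right m_assoc m_closed)
    then show ?thesis using ab by (simp add: k int_pow_neg int_pow_int c_def)
  qed
  have "a [^]\<^bsub>H\<^esub> k = a [^]\<^bsub>H\<^esub> (k mod int n + int n * (k div int n))" by simp
  also have "\<dots> = a [^]\<^bsub>H\<^esub> (k mod int n)"
    using ab an by (simp only: int_pow_mult int_pow_pow [symmetric] int_pow_int int_pow_one r_one int_pow_closed)
  finally show "a [^]\<^bsub>H\<^esub> (k mod int n) = a [^]\<^bsub>H\<^esub> k" by simp
qed

lemma dihedral_mult:
  fixes H :: "('a, 'b) monoid_scheme"
  assumes "group H" and "dihedral_relations n H a b"
  defines "nf \<equiv> \<lambda>(i::int, s). a [^]\<^bsub>H\<^esub> i \<otimes>\<^bsub>H\<^esub> (if s then b else \<one>\<^bsub>H\<^esub>)"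
  shows "nf (i, s) \<otimes>\<^bsub>H\<^esub> nf (j, t) = nf ((if s then i - j else i + j) mod int n, s \<noteq> t)"
proof -
  interpret group H by fact
  have ab: "a \<in> carrier H" "b \<in> carrier H"
    using assms(2) by (auto simp: dihedral_relations_def)
  note nform = dihedral_normal_form [OF assms(1,2)]
  show ?thesis
  proof (cases s)
    case True
    define c where "c = (if t then b else \<one>\<^bsub>H\<^esub>)"
    have c: "c \<in> carrier H" using ab by (simp add: c_def)
    have "nf (i, s) \<otimes>\<^bsub>H\<^esub> nf (j, t) = a [^]\<^bsub>H\<^esub> i \<otimes>\<^bsub>H\<^esub> (b \<otimes>\<^bsub>H\<^esub> a [^]\<^bsub>H\<^esub> j) \<otimes>\<^bsub>H\<^esub> c"
      using ab c True by (simp add: nf_def c_def m_assoc)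
    also have "\<dots> = a [^]\<^bsub>H\<^esub> i \<otimes>\<^bsub>H\<^esub> a [^]\<^bsub>H\<^esub> (- j) \<otimes>\<^bsub>H\<^esub> (b \<otimes>\<^bsub>H\<^esub> c)"
      using ab c by (simp add: nform(2) m_assoc)
    also have "\<dots> = a [^]\<^bsub>H\<^esub> (i - j) \<otimes>\<^bsub>H\<^esub> (b \<otimes>\<^bsub>H\<^esub> c)"
      using ab by (simp flip: int_pow_mult)
    finally show ?thesis using True ab by (simp add: nf_def c_def nform)
  next
    case False
    then show ?thesis using ab by (simp add: nf_def nform(3) int_pow_mult m_assoc)
  qed
qed

lemma dihedral_universal:
  fixes G :: "('a, 'b) monoid_scheme" and H :: "('c, 'd) monoid_scheme"
  assumes "n > 0"
    and "group G" "order G = 2 * n" "dihedral_relations n G r f" "generate G {r, f} = carrier G"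
    and "group H" "dihedral_relations n H a b"
  shows "\<exists>h \<in> hom G H. h r = a \<and> h f = b"
proof -
  interpret G: group G by fact
  interpret H: group H by fact
  have rf: "r \<in> carrier G" "f \<in> carrier G"
    using assms(4) by (auto simp: dihedral_relations_def)
  have ab: "a \<in> carrier H" "b \<in> carrier H"
    using assms(7) by (auto simp: dihedral_relations_def)
  define I where "I = {0..<int n} \<times> (UNIV :: bool set)"
  define g where "g = (\<lambda>(i::int, s). r [^]\<^bsub>G\<^esub> i \<otimes>\<^bsub>G\<^esub> (if s then f else \<one>\<^bsub>G\<^esub>))"
  define h where "h = (\<lambda>(i::int, s). a [^]\<^bsub>H\<^esub> i \<otimes>\<^bsub>H\<^esub> (if s then b else \<one>\<^bsub>H\<^esub>))"
  define m where "m = (\<lambda>(i, s) (j, t). ((if s then i - j else i + j) mod int n, s \<noteq> t))"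
  have gm: "g x \<otimes>\<^bsub>G\<^esub> g y = g (m x y)" for x y
    using dihedral_mult [OF assms(2,4)] by (cases x; cases y) (simp add: g_def m_def)
  have hm: "h x \<otimes>\<^bsub>H\<^esub> h y = h (m x y)" for x y
    using dihedral_mult [OF assms(6,7)] by (cases x; cases y) (simp add: h_def m_def)
  have mI: "m x y \<in> I" for x y
    using assms(1) by (cases x; cases y) (auto simp: m_def I_def)
  have g1: "r = g (1 mod int n, False)" "f = g (0, True)"
    and h1: "a = h (1 mod int n, False)" "b = h (0, True)"
    using rf ab dihedral_normal_form(3) [OF assms(2,4)] dihedral_normal_form(3) [OF assms(6,7)]
    by (simp_all add: g_def h_def)
  have I1: "(1 mod int n, False) \<in> I" "(0, True) \<in> I" using assms(1) by (auto simp: I_def)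
  have ginv: "\<exists>y\<in>I. inv\<^bsub>G\<^esub> (g x) = g y" if "x \<in> I" for x
  proof -
    obtain i s where x: "x = (i, s)" by (cases x)
    define y where "y = (if s then (i, s) else ((- i) mod int n, s))"
    have "y \<in> I" using that assms(1) by (auto simp: x y_def I_def)
    moreover have "g y \<otimes>\<^bsub>G\<^esub> g x = \<one>\<^bsub>G\<^esub>"
      by (simp add: gm m_def x y_def mod_simps) (simp add: g_def)
    then have "inv\<^bsub>G\<^esub> (g x) = g y" using rf by (intro G.inv_equality) (auto simp: g_def x y_def)
    ultimately show ?thesis by blast
  qed
  have sub: "generate G {r, f} \<subseteq> g ` I"
  proof
    fix z assume "z \<in> generate G {r, f}"
    then show "z \<in> g ` I"
    proof induction
      case one
      have "\<one>\<^bsub>G\<^esub> = g (0, False)" by (simp add: g_def)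
      then show ?case using assms(1) by (auto simp: I_def)
    next
      case (incl z) then show ?case using g1 I1 by blast
    next
      case (inv z)
      then have "z = g (1 mod int n, False) \<or> z = g (0, True)" using g1 by simp
      then show ?case using ginv I1 by blast
    next
      case (eng z1 z2) then show ?case using gm mI by auto
    qed
  qed
  have "g x \<in> carrier G" for x using rf by (cases x) (simp add: g_def)
  then have surj: "g ` I = carrier G" using sub unfolding assms(5) by blast
  have "card (g ` I) = card I"
    unfolding surj using assms(3) by (simp add: order_def I_def card_cartesian_product)
  then have inj: "inj_on g I" by (intro eq_card_imp_inj_on) (auto simp: I_def)
  define k where "k = (\<lambda>x. h (inv_into I g x))"
  have kg: "k (g x) = h x" if "x \<in> I" for x using inj that by (simp add: k_def)
  have "k \<in> hom G H"
  proof (rule homI)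
    fix x assume "x \<in> carrier G"
    then show "k x \<in> carrier H"
      using ab by (cases "inv_into I g x") (simp add: k_def h_def)
  next
    fix x y assume "x \<in> carrier G" "y \<in> carrier G"
    then obtain u v where "u \<in> I" "v \<in> I" "x = g u" "y = g v" using surj by blast
    then show "k (x \<otimes>\<^bsub>G\<^esub> y) = k x \<otimes>\<^bsub>H\<^esub> k y" by (simp add: gm hm kg mI)
  qed
  moreover have "k r = a" "k f = b"
    unfolding g1 h1 using kg I1 by blast+
  ultimately show ?thesis by blast
qed

end

theory Submission
  imports Defs
begin

hide_const (open) Divisibility.prime

text \<open>
  A player who can only lose now or lose later ranks third either way, so the outcome is the one
  reached when nobody loses voluntarily. Play without voluntary losses continues until the selected
  elements fill a maximal subgroup \<open>M\<close>; the mover who completes \<open>M\<close> wins, and hence the winner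
  depends only on the order of \<open>M\<close> modulo 3 (\<open>winner_from_maximal_subgroup\<close>).

  The maximal subgroups of \<open>D\<^sub>n\<close> are the rotation group, of order \<open>n\<close>, and the dihedral groups
  generated by \<open>r\<^sup>p\<close> and a reflection for the primes \<open>p\<close> dividing \<open>n\<close>, of order \<open>2 * n / p\<close>
  (\<open>maximal_subgroup_cases\<close>). One or two selections therefore settle the game: the rotation \<open>r\<close>
  forces the rotation group, while a reflection together with \<open>r\<^sup>q\<close>, for a prime divisor \<open>q\<close> of \<open>n\<close>,
  forces order \<open>2 * n / q\<close>. What remains is to see who profits.

  \<^item> If \<open>n \<equiv> 1\<close> modulo 3, Player 1 selects \<open>r\<close>.

  \<^item> If \<open>n \<equiv> 2\<close> modulo 3, all orders are prime to 3, so Player 3 never wins. Player 2 answers a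
    rotation by the rotation group, and a reflection by \<open>r\<^sup>q\<close> for a prime divisor
    \<open>q \<equiv> 2\<close> of \<open>n\<close>; both orders are 2 modulo 3.

  \<^item> If 3 divides \<open>n\<close>, Player 3 wins in every maximal subgroup except those with \<open>p = 3\<close>,
    which have order \<open>2 * n / 3\<close>. For \<open>n \<equiv> 0\<close> modulo 9 these are no exception. For
    \<open>n \<equiv> 3\<close> they favour Player 2; Player 1, who is second when Player 2 wins, selects a
    reflection and Player 2 selects \<open>r\<^sup>3\<close>. For \<open>n \<equiv> 6\<close> they favour Player 1, and Player 2, who
    is second when Player 3 wins, avoids them by the same answers as for \<open>n \<equiv> 2\<close> modulo 3, now
    with a prime divisor \<open>q \<equiv> 2\<close> of \<open>n / 3\<close>.
\<close>

section \<open>Outcomes of the avoidance game and maximal subgroups\<close>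

definition maximal_subgroup :: "'a set \<Rightarrow> ('a, 'b) monoid_scheme \<Rightarrow> bool" where
  "maximal_subgroup M G \<longleftrightarrow>
     subgroup M G \<and> M \<noteq> carrier G \<and>
     (\<forall>H. subgroup H G \<longrightarrow> M \<subseteq> H \<longrightarrow> H = M \<or> H = carrier G)"

text \<open>
  Selections are counted from 1, so that \<open>nth_player (card S)\<close> made the last selection in \<open>S\<close>;
  \<open>nth_player 0\<close> is the predecessor of the first mover in the cyclic order.
\<close>

definition nth_player :: "nat \<Rightarrow> player" where
  "nth_player m = (if m mod 3 = 1 then P1 else if m mod 3 = 2 then P2 else P3)"

lemma next_nth_player [simp]: "next_player (nth_player m) = nth_player (Suc m)"
  using mod_less_divisor [of 3 m] by (auto simp: nth_player_def mod_Suc)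

lemma prev_nth_player [simp]: "prev_player (nth_player (Suc m)) = nth_player m"
  using mod_less_divisor [of 3 m] by (auto simp: nth_player_def mod_Suc)

lemma place_less_3_iff: "place w p < 3 \<longleftrightarrow> w \<noteq> prev_player p"
  by (cases w; cases p) (auto simp: place_def)

context group
begin

definition safe_moves :: "'a set \<Rightarrow> 'a set" where
  "safe_moves S = {x \<in> carrier G - S. generate G (insert x S) \<noteq> carrier G}"

lemma safe_movesI:
  assumes "subgroup H G" "H \<noteq> carrier G" "insert x S \<subseteq> H" "x \<notin> S"
  shows "x \<in> safe_moves S"
  using assms generate_subgroup_incl [OF assms(3,1)] subgroup.subset [OF assms(1)]
  by (auto simp: safe_moves_def)

lemma bi_winner_no_safe_move:
  assumes "finite (carrier G)" "carrier G - S \<noteq> {}" "safe_moves S = {}"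
  shows "bi_winner G S p = prev_player p"
proof -
  have "(\<lambda>x. if generate G (insert x S) = carrier G then prev_player p
             else bi_winner G (insert x S) (next_player p)) ` (carrier G - S)
        = (\<lambda>x. prev_player p) ` (carrier G - S)"
    using assms(3) by (intro image_cong) (auto simp: safe_moves_def)
  also have "\<dots> = {prev_player p}"
    using assms(2) by auto
  finally show ?thesis
    using assms(1) arg_min_if_finite(1) [of "{prev_player p}" "\<lambda>w. place w p"]
    by (simp add: bi_winner.simps [of G S p])
qed

text \<open>
  An immediate loss puts the mover third, and no safe move can do worse. When the loss is
  nevertheless optimal, every safe move has the same outcome, so generating moves can be ignored
  as long as a safe move exists.
\<close>

lemma bi_winner_best_safe_move:
  assumes fin: "finite (carrier G)" and y: "y \<in> safe_moves S"
  obtains x where "x \<in> safe_moves S"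
    "bi_winner G S p = bi_winner G (insert x S) (next_player p)"
    "place (bi_winner G S p) p \<le> place (bi_winner G (insert y S) (next_player p)) p"
proof -
  define v where "v = (\<lambda>x. if generate G (insert x S) = carrier G then prev_player p
                            else bi_winner G (insert x S) (next_player p))"
  have W: "bi_winner G S p = arg_min_on (\<lambda>w. place w p) (v ` (carrier G - S))"
    using fin by (simp add: bi_winner.simps [of G S p] v_def)
  have finv: "finite (v ` (carrier G - S))" and ne: "v ` (carrier G - S) \<noteq> {}"
    using fin y by (auto simp: safe_moves_def)
  have safe: "v x = bi_winner G (insert x S) (next_player p)" if "x \<in> safe_moves S" for x
    using that by (simp add: v_def safe_moves_def)
  have mem: "bi_winner G S p \<in> v ` (carrier G - S)"
    unfolding W using arg_min_if_finite(1) [OF finv ne] .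
  have le: "place (bi_winner G S p) p \<le> place (v y) p"
    using arg_min_if_finite(2) [OF finv ne, of "\<lambda>w. place w p"] y
    unfolding W safe_moves_def by (auto simp: not_less)
  show thesis
  proof (cases "bi_winner G S p = prev_player p")
    case True
    then have "v y = bi_winner G S p"
      using le place_less_3_iff [of _ p] by (metis order.strict_trans1)
    then show thesis using that [of y] y safe [OF y] by simp
  next
    case False
    obtain x where "x \<in> carrier G - S" "bi_winner G S p = v x" using mem by auto
    with False have "x \<in> safe_moves S" by (auto simp: v_def safe_moves_def)
    then show thesis using that [of x] safe le y \<open>bi_winner G S p = v x\<close> by metis
  qed
qed

lemma bi_winner_place_le:
  assumes "finite (carrier G)" "y \<in> safe_moves S"
  shows "place (bi_winner G S p) p \<le> place (bi_winner G (insert y S) (next_player p)) p"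
  using bi_winner_best_safe_move [OF assms] by metis

text \<open>
  Safe moves only shrink the set of maximal subgroups above the position, and a position without
  safe moves is itself a maximal subgroup, completed by the last mover.
\<close>

lemma winner_from_maximal_subgroup:
  assumes fin: "finite (carrier G)" and "S \<subseteq> carrier G" "generate G S \<noteq> carrier G"
  shows "\<exists>M. maximal_subgroup M G \<and> S \<subseteq> M \<and>
             bi_winner G S (nth_player (Suc (card S))) = nth_player (card M)"
  using assms(2,3)
proof (induction "card (carrier G - S)" arbitrary: S rule: less_induct)
  case less
  have finS: "finite S" using less.prems(1) fin finite_subset by blast
  have sub_gen: "S \<subseteq> generate G S" by (auto intro: generate.incl)
  have gen: "subgroup (generate G S) G" using generate_is_subgroup less.prems(1) .
  show ?case
  proof (cases "safe_moves S = {}")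
    case True
    have closed: "H = S" if H: "subgroup H G" "H \<noteq> carrier G" "S \<subseteq> H" for H
      using safe_movesI [OF H(1,2)] H(3) True by blast
    have "generate G S = S" using closed gen less.prems(2) sub_gen by blast
    with gen less.prems(2) closed have "maximal_subgroup S G"
      by (auto simp: maximal_subgroup_def)
    moreover have "carrier G - S \<noteq> {}"
      using less.prems \<open>generate G S = S\<close> by auto
    ultimately show ?thesis using bi_winner_no_safe_move [OF fin _ True] by auto
  next
    case False
    then obtain x where x: "x \<in> safe_moves S"
      and W: "bi_winner G S (nth_player (Suc (card S)))
              = bi_winner G (insert x S) (next_player (nth_player (Suc (card S))))"
      using bi_winner_best_safe_move [OF fin] by blast
    have x': "x \<in> carrier G" "x \<notin> S" "generate G (insert x S) \<noteq> carrier G"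
      using x by (auto simp: safe_moves_def)
    have "carrier G - insert x S \<subset> carrier G - S" using x' by auto
    then have "card (carrier G - insert x S) < card (carrier G - S)"
      using fin by (intro psubset_card_mono) auto
    from less.hyps [OF this] x' less.prems(1) W finS show ?thesis by auto
  qed
qed

text \<open>
  The form used to evaluate positions: \<open>H\<close> witnesses that the game is not over yet, and \<open>W\<close> collects
  the outcomes that are still possible.
\<close>

lemma winner_in_orders:
  assumes "finite (carrier G)" "subgroup H G" "H \<noteq> carrier G" "S \<subseteq> H" "card S = k"
    and "\<And>M. maximal_subgroup M G \<Longrightarrow> S \<subseteq> M \<Longrightarrow> nth_player (card M) \<in> W"
  shows "bi_winner G S (nth_player (Suc k)) \<in> W"
proof -
  have "S \<subseteq> carrier G" "generate G S \<noteq> carrier G"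
    using assms(2-4) generate_subgroup_incl [OF assms(4,2)] subgroup.subset [OF assms(2)] by auto
  then show ?thesis
    using winner_from_maximal_subgroup [OF assms(1)] assms(5,6) by metis
qed

end

section \<open>The maximal subgroups of a dihedral group\<close>

locale dihedral = group G for G :: "('a, 'b) monoid_scheme" (structure) +
  fixes n :: nat and r f :: 'a
  assumes n_pos: "n > 0" and order_eq: "order G = 2 * n"
    and relations: "dihedral_relations n G r f"
    and generated: "generate G {r, f} = carrier G"
begin

definition rot :: "int \<Rightarrow> 'a" where "rot i = r [^] i"
definition refln :: "int \<Rightarrow> 'a" where "refln i = r [^] i \<otimes> f"

text \<open>
  The subgroups generated by \<open>r\<^sup>d\<close>, and by \<open>r\<^sup>d\<close> and the reflection \<open>r\<^sup>j f\<close>. Integer exponents make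
  membership in them a matter of divisibility.
\<close>

definition rotations :: "int \<Rightarrow> 'a set" where
  "rotations d = range (\<lambda>a. rot (d * a))"

definition dihedral_sub :: "int \<Rightarrow> int \<Rightarrow> 'a set" where
  "dihedral_sub d j = rotations d \<union> range (\<lambda>a. refln (d * a + j))"

lemma rf_closed: "r \<in> carrier G" "f \<in> carrier G"
  using relations by (auto simp: dihedral_relations_def)

lemma rot_closed [simp]: "rot i \<in> carrier G" and refln_closed [simp]: "refln i \<in> carrier G"
  using rf_closed by (auto simp: rot_def refln_def)

lemma rot_mod: "rot (i mod int n) = rot i"
  using dihedral_normal_form(3) [OF is_group relations] by (simp add: rot_def)

lemma refln_mod: "refln (i mod int n) = refln i"
  using rot_mod [of i] by (simp add: rot_def refln_def)

lemma dihedral_mult_table [simp]: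
  "rot i \<otimes> rot j = rot (i + j)" "rot i \<otimes> refln j = refln (i + j)"
  "refln i \<otimes> rot j = refln (i - j)" "refln i \<otimes> refln j = rot (i - j)"
  using dihedral_mult [OF is_group relations, of i False j False]
    dihedral_mult [OF is_group relations, of i False j True]
    dihedral_mult [OF is_group relations, of i True j False]
    dihedral_mult [OF is_group relations, of i True j True]
    rot_mod refln_mod rf_closed
  by (simp_all add: rot_def refln_def)

lemma rot_0: "rot 0 = \<one>"
  by (simp add: rot_def)

lemma rot_1: "rot 1 = r" and refln_0: "refln 0 = f"
  using rf_closed by (simp_all add: rot_def refln_def)

lemma inv_rot [simp]: "inv (rot i) = rot (- i)" and inv_refln [simp]: "inv (refln i) = refln i"
  by (rule inv_equality; simp add: rot_0)+

lemma subgroup_rotations: "subgroup (rotations d) G"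
proof (rule subgroupI)
  fix x y assume "x \<in> rotations d" "y \<in> rotations d"
  then obtain a b where "x = rot (d * a)" "y = rot (d * b)" by (auto simp: rotations_def)
  then have "x \<otimes> y = rot (d * (a + b))" "inv x = rot (d * (- a))"
    by (simp_all add: distrib_left)
  then show "x \<otimes> y \<in> rotations d" "inv x \<in> rotations d"
    unfolding rotations_def by blast+
qed (auto simp: rotations_def)

lemma subgroup_dihedral_sub: "subgroup (dihedral_sub d j) G"
proof (rule subgroupI)
  fix x y assume xy: "x \<in> dihedral_sub d j" "y \<in> dihedral_sub d j"
  have rotI: "rot (d * c) \<in> dihedral_sub d j" and reflnI: "refln (d * c + j) \<in> dihedral_sub d j"
    for c by (auto simp: dihedral_sub_def rotations_def)
  from xy obtain a b where
    "x = rot (d * a) \<or> x = refln (d * a + j)" "y = rot (d * b) \<or> y = refln (d * b + j)"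
    by (auto simp: dihedral_sub_def rotations_def)
  then show "x \<otimes> y \<in> dihedral_sub d j" "inv x \<in> dihedral_sub d j"
    using rotI [of "a + b"] rotI [of "a - b"] rotI [of "- a"]
      reflnI [of "a + b"] reflnI [of "a - b"] reflnI [of a]
    by (auto simp: algebra_simps)
qed (auto simp: dihedral_sub_def rotations_def)

lemma carrier_eq: "carrier G = range rot \<union> range refln"
proof -
  have "rot 1 \<in> dihedral_sub 1 0" "refln 0 \<in> dihedral_sub 1 0"
    by (auto simp: dihedral_sub_def rotations_def)
  then have "r \<in> dihedral_sub 1 0" "f \<in> dihedral_sub 1 0"
    by (simp_all add: rot_1 refln_0)
  then have "carrier G \<subseteq> dihedral_sub 1 0"
    using generate_subgroup_incl [OF _ subgroup_dihedral_sub [of 1 0], of "{r, f}"] generated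
    by auto
  then show ?thesis by (auto simp: dihedral_sub_def rotations_def)
qed

lemma finite_carrier: "finite (carrier G)"
  using order_eq n_pos by (auto simp: order_def intro: card_ge_0_finite)

text \<open>
  The \<open>2 * n\<close> normal forms exhaust a group of order \<open>2 * n\<close>, so they are pairwise distinct.
\<close>

lemma rot_eq_iff: "rot i = rot j \<longleftrightarrow> i mod int n = j mod int n"
  and rot_neq_refln: "rot i \<noteq> refln j"
proof -
  define I where "I = {0..<int n} \<times> (UNIV :: bool set)"
  define g where "g = (\<lambda>(i, s). if s then refln i else rot i)"
  have mod_in: "(k mod int n, s) \<in> I" for k s using n_pos by (simp add: I_def)
  have g_mod: "g (k mod int n, s) = g (k, s)" for k s
    by (simp add: g_def rot_mod refln_mod)
  have "rot k \<in> g ` I" "refln k \<in> g ` I" for k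
    using mod_in [of k False] mod_in [of k True] g_mod [of k False] g_mod [of k True]
    by (force simp: g_def)+
  moreover have "g x \<in> carrier G" for x by (cases x) (simp add: g_def)
  ultimately have "g ` I = carrier G"
    by (intro equalityI) (blast, auto simp: carrier_eq)
  then have "card (g ` I) = card I"
    using order_eq by (simp add: order_def I_def card_cartesian_product)
  then have inj: "inj_on g I" by (intro eq_card_imp_inj_on) (auto simp: I_def)
  have g_eq: "g (i, s) = g (j, t) \<longleftrightarrow> i mod int n = j mod int n \<and> s = t" for s t
    using inj_on_eq_iff [OF inj mod_in mod_in, of i s j t] by (simp add: g_mod)
  show "rot i = rot j \<longleftrightarrow> i mod int n = j mod int n" "rot i \<noteq> refln j"
    using g_eq [of False False] g_eq [of False True] by (simp_all add: g_def)
qed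

lemma rot_in_dihedral_sub_iff:
  assumes "d dvd int n"
  shows "rot i \<in> dihedral_sub d j \<longleftrightarrow> d dvd i"
proof
  assume "rot i \<in> dihedral_sub d j"
  then obtain a where "i mod int n = (d * a) mod int n"
    by (auto simp: dihedral_sub_def rotations_def rot_eq_iff rot_neq_refln)
  then show "d dvd i" using assms by (metis dvd_mod_iff dvd_triv_left)
qed (auto simp: dihedral_sub_def rotations_def)

lemma dihedral_sub_proper:
  assumes "prime p" "p dvd n"
  shows "dihedral_sub (int p) j \<noteq> carrier G"
proof -
  have "\<not> int p dvd 1" using assms(1) by (auto dest: prime_gt_1_nat)
  then have "rot 1 \<notin> dihedral_sub (int p) j"
    using rot_in_dihedral_sub_iff assms(2) by simp
  then show ?thesis using rot_closed by metis
qed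

lemma refln_notin_rotations: "refln j \<notin> rotations d"
  using rot_neq_refln [THEN not_sym] by (auto simp: rotations_def)

lemma rotations_proper: "rotations d \<noteq> carrier G"
  using refln_notin_rotations refln_closed [of 0] by blast

lemma card_rotations:
  assumes n: "n = d * m"
  shows "card (rotations (int d)) = m"
proof -
  have dm: "d > 0" "m > 0" using n n_pos by auto
  have "rotations (int d) = (\<lambda>a. rot (int d * a)) ` {0..<int m}"
  proof -
    have "rot (int d * a) \<in> (\<lambda>a. rot (int d * a)) ` {0..<int m}" for a
      by (rule image_eqI [where x = "a mod int m"]) (use dm in \<open>simp_all add: rot_eq_iff n\<close>)
    then show ?thesis by (auto simp: rotations_def)
  qed
  moreover have "inj_on (\<lambda>a. rot (int d * a)) {0..<int m}"
    using dm by (auto simp: inj_on_def rot_eq_iff n)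
  ultimately show ?thesis by (simp add: card_image)
qed

lemma card_dihedral_sub:
  assumes "n = d * m"
  shows "card (dihedral_sub (int d) j) = 2 * m"
proof -
  have eq: "range (\<lambda>a. refln (int d * a + j)) = (\<lambda>x. x \<otimes> refln j) ` rotations (int d)"
    by (auto simp: rotations_def image_image)
  have "inj_on (\<lambda>x. x \<otimes> refln j) (rotations (int d))"
    using subgroup.subset [OF subgroup_rotations] by (intro inj_onI) (metis refln_closed r_cancel subsetD)
  then have "card (range (\<lambda>a. refln (int d * a + j))) = m"
    using card_rotations [OF assms] by (simp add: eq card_image)
  moreover have "rotations (int d) \<inter> range (\<lambda>a. refln (int d * a + j)) = {}"
    using refln_notin_rotations by auto
  moreover have "finite (rotations (int d))"
    by (rule finite_subset [OF subgroup.subset [OF subgroup_rotations] finite_carrier])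
  moreover have "finite (range (\<lambda>a. refln (int d * a + j)))"
    by (rule finite_subset [OF _ finite_carrier]) auto
  ultimately show ?thesis
    using card_rotations [OF assms] by (simp add: dihedral_sub_def card_Un_disjoint)
qed

text \<open>
  The exponents of the rotations in a subgroup form an ideal of the integers, which is principal.
\<close>

lemma rotation_exponents_principal:
  assumes H: "subgroup H G"
  obtains d where "d > 0" "d dvd int n" "\<And>i. rot i \<in> H \<longleftrightarrow> d dvd i"
proof -
  interpret H: subgroup H G by fact
  define k where "k = (LEAST k. k > 0 \<and> rot (int k) \<in> H)"
  have rot_n: "rot (int n) \<in> H"
    using H.one_closed rot_mod [of "int n"] by (metis mod_self rot_0)
  have k: "k > 0" "rot (int k) \<in> H"
    using LeastI [of "\<lambda>k. k > 0 \<and> rot (int k) \<in> H" n] n_pos rot_n unfolding k_def by auto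
  have least: "k \<le> l" if "l > 0" "rot (int l) \<in> H" for l
    unfolding k_def using that by (intro Least_le) simp
  have multiples: "rot (int k * c) \<in> H" for c
  proof (induction c rule: int_induct [where k = 0])
    case base show ?case using H.one_closed by (simp add: rot_0)
  next
    case (step1 c)
    show ?case using H.m_closed [OF step1(2) k(2)] by (simp add: algebra_simps)
  next
    case (step2 c)
    show ?case using H.m_closed [OF step2(2) H.m_inv_closed [OF k(2)]] by (simp add: algebra_simps)
  qed
  have iff: "rot i \<in> H \<longleftrightarrow> int k dvd i" for i
  proof
    assume "rot i \<in> H"
    then have "rot i \<otimes> rot (int k * (- (i div int k))) \<in> H"
      using multiples H.m_closed by blast
    then have "rot (i mod int k) \<in> H"
      by (simp add: minus_mult_div_eq_mod)
    then have "i mod int k > 0 \<Longrightarrow> k \<le> nat (i mod int k)"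
      using least by simp
    moreover have "0 \<le> i mod int k" "i mod int k < int k" using k(1) by simp_all
    ultimately have "i mod int k = 0" by linarith
    then show "int k dvd i" by presburger
  qed (use multiples in auto)
  then show thesis using that [of "int k"] k(1) rot_n by simp
qed

text \<open>
  If \<open>M\<close> contains a reflection \<open>r\<^sup>j f\<close> and its rotations are the powers of \<open>r\<^sup>d\<close>, then \<open>d \<noteq> 1\<close> because
  \<open>M\<close> is proper, and \<open>M\<close> lies below the subgroup generated by \<open>r\<^sup>p\<close> and \<open>r\<^sup>j f\<close> for any prime \<open>p\<close>
  dividing \<open>d\<close>.
\<close>

lemma maximal_subgroup_cases:
  assumes M: "maximal_subgroup M G"
  obtains "M = rotations 1"
  | p j where "prime p" "p dvd n" "M = dihedral_sub (int p) j"
proof (cases "\<exists>j. refln j \<in> M")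
  case False
  have sub: "M \<subseteq> carrier G" using M by (auto simp: maximal_subgroup_def dest: subgroup.subset)
  with False have "M \<subseteq> rotations 1" by (auto simp: carrier_eq rotations_def)
  then show thesis
    using that(1) M subgroup_rotations rotations_proper unfolding maximal_subgroup_def by metis
next
  case True
  then obtain j where j: "refln j \<in> M" ..
  have sg: "subgroup M G" using M by (simp add: maximal_subgroup_def)
  then interpret M: subgroup M G .
  obtain d where d: "d > 0" "d dvd int n" "\<And>i. rot i \<in> M \<longleftrightarrow> d dvd i"
    using rotation_exponents_principal [OF sg] by blast
  have refln_iff: "refln i \<in> M \<longleftrightarrow> d dvd i - j" for i
    using M.m_closed [OF _ j, of "refln i"] M.m_closed [OF _ j, of "rot (i - j)"] d(3) by auto
  have "d \<noteq> 1"
  proof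
    assume "d = 1"
    then have "carrier G \<subseteq> M" using d(3) refln_iff by (auto simp: carrier_eq)
    then show False using M M.subset by (auto simp: maximal_subgroup_def)
  qed
  then obtain p where p: "prime p" "p dvd nat d"
    using prime_factor_nat [of "nat d"] d(1) by (auto simp: nat_eq_iff)
  have pd: "int p dvd d" using p(2) d(1) by (metis int_dvd_int_iff int_nat_eq less_imp_le)
  then have pn: "p dvd n" using d(2) by (metis dvd_trans int_dvd_int_iff)
  have "M \<subseteq> dihedral_sub (int p) j"
  proof
    fix x assume x: "x \<in> M"
    then have "x \<in> range rot \<union> range refln" using M.subset carrier_eq by auto
    then consider i where "x = rot i" | i where "x = refln i" by blast
    then show "x \<in> dihedral_sub (int p) j"
    proof cases
      case 1
      then have "int p dvd i" using x d(3) pd dvd_trans by blast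
      then show ?thesis using 1 by (auto simp: dihedral_sub_def rotations_def)
    next
      case 2
      then have "int p dvd i - j" using x refln_iff pd dvd_trans by blast
      then obtain c where "i = int p * c + j" by (metis dvd_def diff_add_cancel)
      then show ?thesis using 2 by (auto simp: dihedral_sub_def)
    qed
  qed
  then have "M = dihedral_sub (int p) j"
    using M subgroup_dihedral_sub dihedral_sub_proper [OF p(1) pn]
    unfolding maximal_subgroup_def by metis
  then show thesis using that(2) p(1) pn by blast
qed

lemma card_maximal_subgroup:
  assumes "maximal_subgroup M G"
  shows "card M = n \<or> (\<exists>p m. prime p \<and> n = p * m \<and> card M = 2 * m)"
  using assms
proof (cases rule: maximal_subgroup_cases)
  case 1
  then show ?thesis using card_rotations [of 1 n] by simp
next
  case (2 p j)
  then show ?thesis using card_dihedral_sub by (metis dvd_def)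
qed

text \<open>
  A rotation \<open>r\<^sup>k\<close> excludes the dihedral maximal subgroups for all primes \<open>p\<close> that do not divide \<open>k\<close>:
  all of them for \<open>k = 1\<close>, and all but those with \<open>p = q\<close> for a prime \<open>k = q\<close>.
\<close>

lemma card_maximal_subgroup_r:
  assumes "maximal_subgroup M G" "rot 1 \<in> M"
  shows "card M = n"
  using assms(1)
proof (cases rule: maximal_subgroup_cases)
  case 1
  then show ?thesis using card_rotations [of 1 n] by simp
next
  case (2 p j)
  then have "int p dvd 1" using assms(2) rot_in_dihedral_sub_iff by simp
  then show ?thesis using \<open>prime p\<close> prime_gt_1_nat by auto
qed

lemma card_maximal_subgroup_refln_rot:
  assumes "maximal_subgroup M G" "prime q" "n = q * m" "rot (int q) \<in> M" "refln j \<in> M"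
  shows "card M = 2 * m"
  using assms(1)
proof (cases rule: maximal_subgroup_cases)
  case 1
  then show ?thesis using assms(5) refln_notin_rotations by auto
next
  case (2 p i)
  then have "int p dvd int q" using assms(4) rot_in_dihedral_sub_iff by simp
  then have "p = q" using \<open>prime p\<close> assms(2) by (simp add: primes_dvd_imp_eq)
  then show ?thesis using 2 assms(3) card_dihedral_sub by simp
qed

section \<open>The game on a dihedral group\<close>

lemma winner_rotation_with_r:
  assumes "i mod int n \<noteq> 1 mod int n"
  shows "bi_winner G {rot 1, rot i} P3 = nth_player n"
proof -
  have "{rot 1, rot i} \<subseteq> rotations 1" by (auto simp: rotations_def)
  moreover have "card {rot 1, rot i} = 2" using assms by (auto simp: rot_eq_iff card_insert_if)
  ultimately have "bi_winner G {rot 1, rot i} (nth_player (Suc 2)) \<in> {nth_player n}"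
    by (intro winner_in_orders [OF finite_carrier subgroup_rotations rotations_proper])
      (auto simp: card_maximal_subgroup_r)
  then show ?thesis by (simp add: nth_player_def)
qed

lemma winner_refln_with_rot:
  assumes "prime q" "n = q * m"
  shows "rot (int q) \<in> safe_moves {refln j}"
    and "bi_winner G {rot (int q), refln j} P3 = nth_player (2 * m)"
proof -
  have proper: "dihedral_sub (int q) j \<noteq> carrier G" using dihedral_sub_proper assms by simp
  have "rot (int q * 1) \<in> dihedral_sub (int q) j" "refln (int q * 0 + j) \<in> dihedral_sub (int q) j"
    unfolding dihedral_sub_def rotations_def by blast+
  then have sub: "{rot (int q), refln j} \<subseteq> dihedral_sub (int q) j" by simp
  then show "rot (int q) \<in> safe_moves {refln j}"
    by (intro safe_movesI [OF subgroup_dihedral_sub proper]) (auto simp: rot_neq_refln)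
  have "card {rot (int q), refln j} = 2" using rot_neq_refln by simp
  with sub have "bi_winner G {rot (int q), refln j} (nth_player (Suc 2)) \<in> {nth_player (2 * m)}"
    by (intro winner_in_orders [OF finite_carrier subgroup_dihedral_sub proper])
      (auto simp: card_maximal_subgroup_refln_rot [OF _ assms])
  then show "bi_winner G {rot (int q), refln j} P3 = nth_player (2 * m)"
    by (simp add: nth_player_def)
qed

text \<open>
  The prime divisor excludes \<open>n = 1\<close>, where the reflection generates the group.
\<close>

lemma single_element_in_proper_subgroup:
  assumes "prime q" "q dvd n" "x \<in> carrier G"
  obtains H where "subgroup H G" "H \<noteq> carrier G" "x \<in> H"
proof -
  from assms(3) consider i where "x = rot i" | j where "x = refln j" by (auto simp: carrier_eq)
  then show thesis
  proof cases
    case 1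
    then have "x \<in> rotations 1" by (auto simp: rotations_def)
    then show thesis using that subgroup_rotations rotations_proper by blast
  next
    case 2
    then have "x = refln (int q * 0 + j)" by simp
    then have "x \<in> dihedral_sub (int q) j" unfolding dihedral_sub_def by blast
    then show thesis using that subgroup_dihedral_sub dihedral_sub_proper assms by blast
  qed
qed

text \<open>
  After a rotation other than \<open>r\<close>, Player 2 forces the rotation group with \<open>r\<close>; after \<open>r\<close>
  itself the neutral element serves as a waiting move.
\<close>

lemma second_player_answer:
  assumes q: "prime q" "n = q * m" and w: "nth_player n = w" "nth_player (2 * m) = w"
    and x: "x \<in> carrier G"
  obtains y where "y \<in> safe_moves {x}" "bi_winner G {y, x} P3 = w"
proof -
  from x consider i where "x = rot i" | j where "x = refln j" by (auto simp: carrier_eq)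
  then show thesis
  proof cases
    case 1
    have "q dvd n" "q > 1" using q prime_gt_1_nat by auto
    then have n: "n > 1" using n_pos dvd_imp_le [of q n] by linarith
    have safe: "rot k \<in> safe_moves {x}" if "rot k \<noteq> x" for k
      using that 1
      by (intro safe_movesI [OF subgroup_rotations [of 1] rotations_proper])
        (auto simp: rotations_def)
    show thesis
    proof (cases "i mod int n = 1 mod int n")
      case False
      then have "rot 1 \<noteq> x" using 1 by (auto simp: rot_eq_iff)
      then show thesis
        using that [of "rot 1"] safe winner_rotation_with_r [OF False] w(1) 1 by simp
    next
      case True
      then have x1: "x = rot 1" using 1 by (simp add: rot_eq_iff)
      have "0 mod int n \<noteq> 1 mod int n" using n by simp
      then show thesis
        using that [of "rot 0"] safe [of 0] winner_rotation_with_r [of 0] w(1) x1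
        by (simp add: rot_eq_iff insert_commute)
    qed
  next
    case 2
    then show thesis using that winner_refln_with_rot [OF q] w(2) by metis
  qed
qed

text \<open>
  Player 1 winning is Player 2's worst outcome. If every other outcome equals \<open>w\<close>, and Player 2 can
  force \<open>w\<close> by the answers above, then \<open>w\<close> wins whatever Player 1 does.
\<close>

lemma second_player_decides:
  assumes q: "prime q" "n = q * m" and w: "nth_player n = w" "nth_player (2 * m) = w" "w \<noteq> P1"
    and orders: "\<And>M. maximal_subgroup M G \<Longrightarrow> nth_player (card M) \<in> {P1, w}"
  shows "bi_winner G {} P1 = w"
proof -
  have answered: "bi_winner G {x} P2 = w" if x: "x \<in> carrier G" for x
  proof -
    obtain H where H: "subgroup H G" "H \<noteq> carrier G" "x \<in> H"
      using single_element_in_proper_subgroup [OF q(1) _ x] q(2) by auto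
    have "bi_winner G {x} (nth_player (Suc 1)) \<in> {P1, w}"
      by (rule winner_in_orders [OF finite_carrier H(1,2)]) (use H(3) orders in auto)
    then have mem: "bi_winner G {x} P2 = P1 \<or> bi_winner G {x} P2 = w"
      by (simp add: nth_player_def)
    obtain y where y: "y \<in> safe_moves {x}" "bi_winner G {y, x} P3 = w"
      using second_player_answer [OF q w(1,2) x] .
    have "place (bi_winner G {x} P2) P2 \<le> place w P2"
      using bi_winner_place_le [OF finite_carrier y(1), of P2] y(2) by simp
    then show ?thesis using mem w(3) place_less_3_iff [of w P2] place_less_3_iff [of P1 P2] by auto
  qed
  have "rot 1 \<in> safe_moves {}"
    by (rule safe_movesI [OF subgroup_rotations [of 1] rotations_proper]) (auto simp: rotations_def)
  then obtain x where "x \<in> safe_moves {}" "bi_winner G {} P1 = bi_winner G {x} P2"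
    using bi_winner_best_safe_move [OF finite_carrier, of _ "{}" P1] by auto
  then show ?thesis using answered by (auto simp: safe_moves_def)
qed

lemma winner_1_mod_3:
  assumes "n mod 3 = 1"
  shows "bi_winner G {} P1 = P1"
proof -
  have r_in: "rot 1 \<in> rotations 1" by (auto simp: rotations_def)
  then have "bi_winner G {rot 1} (nth_player (Suc 1)) \<in> {nth_player n}"
    by (intro winner_in_orders [OF finite_carrier subgroup_rotations rotations_proper])
      (auto simp: card_maximal_subgroup_r)
  then have "bi_winner G {rot 1} P2 = P1" using assms by (simp add: nth_player_def)
  moreover have "rot 1 \<in> safe_moves {}"
    using r_in by (intro safe_movesI [OF subgroup_rotations rotations_proper]) auto
  ultimately have "place (bi_winner G {} P1) P1 \<le> place P1 P1"
    using bi_winner_place_le [OF finite_carrier, of "rot 1" "{}" P1] by simp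
  then show ?thesis by (cases "bi_winner G {} P1") (auto simp: place_def)
qed

text \<open>A product of primes that are all 1 modulo 3 is itself 1 modulo 3.\<close>

lemma exists_prime_divisor_2_mod_3:
  fixes k :: nat
  assumes "k mod 3 = 2"
  shows "\<exists>q. prime q \<and> q dvd k \<and> q mod 3 = 2"
  using assms
proof (induction k rule: less_induct)
  case (less k)
  then have "k \<noteq> 1" "k > 0" by auto
  then obtain p where p: "prime p" "p dvd k" using prime_factor_nat by blast
  then obtain l where l: "k = p * l" by (auto simp: dvd_def)
  have mods: "(p mod 3) * (l mod 3) mod 3 = 2"
    using less.prems l by (simp add: mod_mult_eq)
  have "p mod 3 = 0 \<or> p mod 3 = 1 \<or> p mod 3 = 2" by auto
  then consider "p mod 3 = 2" | "p mod 3 = 1" "l mod 3 = 2" using mods by auto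
  then show ?case
  proof cases
    case 2
    have "l < k" using l p(1) \<open>k > 0\<close> prime_gt_1_nat [OF p(1)] by simp
    then show ?thesis using less.IH 2(2) l by (metis dvd_mult)
  qed (use p in blast)
qed

lemma double_mod_3:
  fixes q m :: nat
  assumes "q mod 3 = 2" "(q * m) mod 3 = 2"
  shows "(2 * m) mod 3 = 2"
  using assms by (metis mod_mult_left_eq)

lemma winner_2_mod_3:
  assumes n: "n mod 3 = 2"
  shows "bi_winner G {} P1 = P2"
proof -
  obtain q m where q: "prime q" "n = q * m" "q mod 3 = 2"
    using exists_prime_divisor_2_mod_3 [OF n] by (auto simp: dvd_def)
  have "nth_player (card M) \<in> {P1, P2}" if "maximal_subgroup M G" for M
  proof -
    have "\<not> 3 dvd k" if "n = p * k" for p k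
      using n that by auto
    then have "\<not> 3 dvd card M"
      using card_maximal_subgroup [OF that] n by (auto simp: prime_dvd_mult_iff)
    then have "card M mod 3 \<noteq> 0" by (simp add: dvd_eq_mod_eq_0)
    then show ?thesis by (auto simp: nth_player_def)
  qed
  then show ?thesis
    using second_player_decides [OF q(1,2), of P2] n double_mod_3 [OF q(3)] q(2)
    by (simp add: nth_player_def)
qed

text \<open>
  If \<open>n = p * m\<close> with a prime \<open>p \<noteq> 3\<close>, then 3 divides \<open>m\<close>, and filling a subgroup of order \<open>2 * m\<close>
  makes Player 3 win; only \<open>p = 3\<close> can change that.
\<close>

lemma multiple_of_3_orders:
  assumes "3 dvd n" "maximal_subgroup M G"
  shows "nth_player (card M) \<in> {P3, nth_player (2 * (n div 3))}"
proof -
  consider "card M = n" | p m where "prime p" "n = p * m" "card M = 2 * m"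
    using card_maximal_subgroup [OF assms(2)] by blast
  then show ?thesis
  proof cases
    case 1
    then show ?thesis using assms(1) by (simp add: nth_player_def)
  next
    case 2
    then consider "p = 3" | "3 dvd m"
      using assms(1) primes_dvd_imp_eq [of 3 p] by (auto simp: prime_dvd_mult_iff)
    then show ?thesis using 2 by cases (auto simp: nth_player_def)
  qed
qed

lemma winner_6_mod_9:
  assumes n: "n mod 9 = 6"
  shows "bi_winner G {} P1 = P3"
proof -
  define k where "k = n div 3"
  have k: "n = 3 * k" "k mod 3 = 2" using n unfolding k_def by presburger+
  obtain q l where q: "prime q" "k = q * l"
    using exists_prime_divisor_2_mod_3 [OF k(2)] by (auto simp: dvd_def)
  have "2 * k mod 3 = 1" using k(2) by presburger
  then have P1: "nth_player (2 * k) = P1" by (simp add: nth_player_def)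
  then have "nth_player (card M) \<in> {P1, P3}" if "maximal_subgroup M G" for M
    using multiple_of_3_orders [OF _ that] k(1) by auto
  moreover have "n = q * (3 * l)" using k(1) q(2) by simp
  ultimately show ?thesis
    using second_player_decides [OF q(1), of "3 * l" P3] k(1) by (simp add: nth_player_def)
qed

lemma winner_0_mod_9:
  assumes n: "n mod 9 = 0"
  shows "bi_winner G {} P1 = P3"
proof -
  obtain k where k: "n = 9 * k" using n by (auto simp: mod_eq_0_iff_dvd dvd_def)
  have "bi_winner G {} (nth_player (Suc 0)) \<in> {P3}"
    using multiple_of_3_orders k
    by (intro winner_in_orders [OF finite_carrier subgroup_rotations rotations_proper])
      (auto simp: nth_player_def)
  then show ?thesis by (simp add: nth_player_def)
qed

lemma winner_3_mod_9:
  assumes n: "n mod 9 = 3"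
  shows "bi_winner G {} P1 = P2"
proof -
  \<comment> \<open>Player 1 opens with a reflection, and \<open>r\<^sup>3\<close> then makes Player 2 win. Being third if Player 3 wins,
    Player 1 has no better opening.\<close>
  define k where "k = n div 3"
  have k: "n = 3 * k" "k mod 3 = 1" using n unfolding k_def by presburger+
  have "2 * k mod 3 = 2" using k(2) by presburger
  then have P2: "nth_player (2 * k) = P2" by (simp add: nth_player_def)
  have "prime (3 :: nat)" by simp
  note answer = winner_refln_with_rot [OF this k(1), of 0]
  have "place (bi_winner G {refln 0} P2) P2 \<le> place P2 P2"
    using bi_winner_place_le [OF finite_carrier answer(1), of P2] answer(2) P2 by simp
  then have "bi_winner G {refln 0} P2 = P2"
    by (cases "bi_winner G {refln 0} P2") (auto simp: place_def)
  moreover obtain H where "subgroup H G" "H \<noteq> carrier G" "refln 0 \<in> H"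
    using single_element_in_proper_subgroup [of 3 "refln 0"] k(1) by auto
  then have "refln 0 \<in> safe_moves {}" using safe_movesI [of H "refln 0" "{}"] by simp
  ultimately have le: "place (bi_winner G {} P1) P1 \<le> place P2 P1"
    using bi_winner_place_le [OF finite_carrier, of "refln 0" "{}" P1] by simp
  have "bi_winner G {} (nth_player (Suc 0)) \<in> {P3, P2}"
    using multiple_of_3_orders k P2
    by (intro winner_in_orders [OF finite_carrier subgroup_rotations rotations_proper]) auto
  then have "bi_winner G {} P1 = P3 \<or> bi_winner G {} P1 = P2" by (simp add: nth_player_def)
  then show ?thesis using le by (auto simp: place_def)
qed

end

theorem theorem3p2:
  fixes n :: nat and G :: "('a, 'b) monoid_scheme"
  assumes "n > 0" and "dihedral_group n G"
  shows "(has_winning_strategy G P1 \<longleftrightarrow> [n = 1] (mod 3)) \<and>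
         (has_winning_strategy G P2 \<longleftrightarrow> [n = 2] (mod 3) \<or> [n = 3] (mod 9)) \<and>
         (has_winning_strategy G P3 \<longleftrightarrow> [n = 0] (mod 9) \<or> [n = 6] (mod 9))"
proof -
  obtain r f where rf: "dihedral_relations n G r f" "generate G {r, f} = carrier G"
    and G: "group G" "order G = 2 * n"
    using assms(2) by (auto simp: dihedral_group_def)
  interpret dihedral G n r f
    using assms(1) rf G by (simp add: dihedral_def dihedral_axioms_def)
  have "n mod 3 = 1 \<or> n mod 3 = 2 \<or> n mod 9 = 0 \<or> n mod 9 = 3 \<or> n mod 9 = 6"
    by presburger
  then consider "n mod 3 = 1" | "n mod 3 = 2" | "n mod 9 = 0" | "n mod 9 = 3" | "n mod 9 = 6"
    by metis
  then show ?thesis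
  proof cases
    case 1
    then have "n mod 9 \<noteq> 0" "n mod 9 \<noteq> 3" "n mod 9 \<noteq> 6" by presburger+
    then show ?thesis
      using 1 winner_1_mod_3 by (simp add: has_winning_strategy_def cong_def)
  next
    case 2
    then have "n mod 9 \<noteq> 0" "n mod 9 \<noteq> 3" "n mod 9 \<noteq> 6" by presburger+
    then show ?thesis
      using 2 winner_2_mod_3 by (simp add: has_winning_strategy_def cong_def)
  next
    case 3
    then have "n mod 3 = 0" by presburger
    then show ?thesis
      using 3 winner_0_mod_9 by (simp add: has_winning_strategy_def cong_def)
  next
    case 4
    then have "n mod 3 = 0" by presburger
    then show ?thesis
      using 4 winner_3_mod_9 by (simp add: has_winning_strategy_def cong_def)
  next
    case 5
    then have "n mod 3 = 0" by presburger
    then show ?thesis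
      using 5 winner_6_mod_9 by (simp add: has_winning_strategy_def cong_def)
  qed
qed

end
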